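(* Assume $|\mathcal{A}|\geq 2$. Possible futures equivalence $\sim_{\mathtt{PF}}$ has no finite, ground-complete, equational axiomatisation over the language $\mathrm{BCCSP}_{\|}$; that is, there is no finite set $\mathcal{E}$ of equations between $\mathrm{BCCSP}_{\|}$ terms that is sound modulo $\sim_{\mathtt{PF}}$ and such that $p\sim_{\mathtt{PF}} q$ implies $\mathcal{E}\vdash p\approx q$ for all closed terms $p,q$.
   Context: Let $\mathcal{A}$ be a finite non-empty set of actions and $\mathcal{V}$ a countably infinite set of variables. $\mathrm{BCCSP}_{\|}$ terms: $t ::= \mathbf{0} \mid x \mid a.t \mid t+t \mid t \,\|\, t$ ($a\in\mathcal{A}$, $x\in\mathcal{V}$). Closed terms are processes. Transitions on processes: $a.p \xrightarrow{a} p$; if $p \xrightarrow{a} p'$ then $p+q \xrightarrow{a} p'$, $q+p \xrightarrow{a} p'$, $p\|q \xrightarrow{a} p'\|q$, $q \| p \xrightarrow{a} q \| p'$. For $\alpha\in\mathcal{A}^*$, $p\xrightarrow{\alpha}p'$ denotes a sequence of transitions labelled by $\alpha$; $\mathtt{T}(p)=\{\alpha\mid \exists p'.\,p\xrightarrow{\alpha}p'\}$. A possible future of $p$ is a pair $(\alpha,X)$ with $p\xrightarrow{\alpha}p'$ and $X=\mathtt{T}(p')$; $p\sim_{\mathtt{PF}}q$ iff $p$ and $q$ have the same possible futures. $\mathcal{E}\vdash t\approx u$ means derivable in equational logic (reflexivity, symmetry, transitivity, substitution instances of equations of $\mathcal{E}$, closure under $a.\_$, $+$, $\|$). An equation $t\approx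 u$ is sound modulo a relation $R$ on processes if $\sigma(t)R\sigma(u)$ for every closed substitution $\sigma$; $\mathcal{E}$ is sound if all its equations are. *)

theory Defs
  imports Main "HOL-Library.Countable"
begin

text \<open>Terms over actions \<open>'a\<close> and variables \<open>'v\<close>; \<open>vars t\<close> is the set of variables occurring in \<open>t\<close>.\<close>

datatype (acts: 'a, vars: 'v) bccsp =
    Zero
  | Var 'v
  | Prefix 'a "('a, 'v) bccsp"
  | Plus "('a, 'v) bccsp" "('a, 'v) bccsp"
  | Par "('a, 'v) bccsp" "('a, 'v) bccsp"

definition is_closed :: "('a, 'v) bccsp \<Rightarrow> bool" where
  "is_closed t \<longleftrightarrow> vars t = {}"

primrec subst :: "('v \<Rightarrow> ('a, 'v) bccsp) \<Rightarrow> ('a, 'v) bccsp \<Rightarrow> ('a, 'v) bccsp" where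
  "subst \<sigma> Zero = Zero"
| "subst \<sigma> (Var x) = \<sigma> x"
| "subst \<sigma> (Prefix a t) = Prefix a (subst \<sigma> t)"
| "subst \<sigma> (Plus t u) = Plus (subst \<sigma> t) (subst \<sigma> u)"
| "subst \<sigma> (Par t u) = Par (subst \<sigma> t) (subst \<sigma> u)"

definition closed_subst :: "('v \<Rightarrow> ('a, 'v) bccsp) \<Rightarrow> bool" where
  "closed_subst \<sigma> \<longleftrightarrow> (\<forall>x. is_closed (\<sigma> x))"

text \<open>
  Processes are the closed terms, and only their transitions matter. The rules are given on all
  terms to avoid a separate type of processes; \<open>step_closed\<close> below shows that the transitions of a
  process stay among processes.
\<close>

inductive step :: "('a, 'v) bccsp \<Rightarrow> 'a \<Rightarrow> ('a, 'v) bccsp \<Rightarrow> bool" where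
  prefix: "step (Prefix a p) a p"
| plus_left: "step p a p' \<Longrightarrow> step (Plus p q) a p'"
| plus_right: "step p a p' \<Longrightarrow> step (Plus q p) a p'"
| par_left: "step p a p' \<Longrightarrow> step (Par p q) a (Par p' q)"
| par_right: "step p a p' \<Longrightarrow> step (Par q p) a (Par q p')"

inductive steps :: "('a, 'v) bccsp \<Rightarrow> 'a list \<Rightarrow> ('a, 'v) bccsp \<Rightarrow> bool" where
  empty: "steps p [] p"
| cons: "step p a p' \<Longrightarrow> steps p' \<alpha> p'' \<Longrightarrow> steps p (a # \<alpha>) p''"

lemma step_closed: "step p a p' \<Longrightarrow> is_closed p \<Longrightarrow> is_closed p'"
  by (induction rule: step.induct) (auto simp: is_closed_def)

lemma subst_closed: "closed_subst \<sigma> \<Longrightarrow> is_closed (subst \<sigma> t)"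
  by (induction t) (auto simp: is_closed_def closed_subst_def)

definition traces :: "('a, 'v) bccsp \<Rightarrow> 'a list set" where
  "traces p = {\<alpha>. \<exists>p'. steps p \<alpha> p'}"

definition possible_futures :: "('a, 'v) bccsp \<Rightarrow> ('a list \<times> 'a list set) set" where
  "possible_futures p = {(\<alpha>, X). \<exists>p'. steps p \<alpha> p' \<and> X = traces p'}"

definition pf_equiv :: "('a, 'v) bccsp \<Rightarrow> ('a, 'v) bccsp \<Rightarrow> bool" (infix "\<sim>PF" 50) where
  "p \<sim>PF q \<longleftrightarrow> possible_futures p = possible_futures q"

text \<open>An equation \<open>t \<approx> u\<close> is the pair \<open>(t, u)\<close>.\<close>

inductive derivable ::
    "(('a, 'v) bccsp \<times> ('a, 'v) bccsp) set \<Rightarrow> ('a, 'v) bccsp \<Rightarrow> ('a, 'v) bccsp \<Rightarrow> bool"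
  for E where
  refl: "derivable E t t"
| sym: "derivable E t u \<Longrightarrow> derivable E u t"
| trans: "derivable E t u \<Longrightarrow> derivable E u v \<Longrightarrow> derivable E t v"
| inst: "(t, u) \<in> E \<Longrightarrow> derivable E (subst \<sigma> t) (subst \<sigma> u)"
| prefix: "derivable E t u \<Longrightarrow> derivable E (Prefix a t) (Prefix a u)"
| plus: "derivable E t u \<Longrightarrow> derivable E t' u' \<Longrightarrow> derivable E (Plus t t') (Plus u u')"
| par: "derivable E t u \<Longrightarrow> derivable E t' u' \<Longrightarrow> derivable E (Par t t') (Par u u')"

definition sound_eq ::
    "(('a, 'v) bccsp \<Rightarrow> ('a, 'v) bccsp \<Rightarrow> bool) \<Rightarrow> ('a, 'v) bccsp \<times> ('a, 'v) bccsp \<Rightarrow> bool" where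
  "sound_eq R e \<longleftrightarrow> (\<forall>\<sigma>. closed_subst \<sigma> \<longrightarrow> R (subst \<sigma> (fst e)) (subst \<sigma> (snd e)))"

definition sound ::
    "(('a, 'v) bccsp \<Rightarrow> ('a, 'v) bccsp \<Rightarrow> bool) \<Rightarrow> (('a, 'v) bccsp \<times> ('a, 'v) bccsp) set \<Rightarrow> bool" where
  "sound R E \<longleftrightarrow> (\<forall>e \<in> E. sound_eq R e)"

definition ground_complete ::
    "(('a, 'v) bccsp \<Rightarrow> ('a, 'v) bccsp \<Rightarrow> bool) \<Rightarrow> (('a, 'v) bccsp \<times> ('a, 'v) bccsp) set \<Rightarrow> bool" where
  "ground_complete R E \<longleftrightarrow>
     (\<forall>p q. is_closed p \<longrightarrow> is_closed q \<longrightarrow> R p q \<longrightarrow> derivable E p q)"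

end

theory Submission
  imports Defs
begin

text \<open>
  Let \<open>p = \<Sum>i=1..n. b a\<^sup>2\<^sup>i b\<close>. The expansion law
  \<open>a \<parallel> p \<approx> a (0 \<parallel> p) + (\<Sum>i=1..n. b (a \<parallel> a\<^sup>2\<^sup>i b))\<close> is sound, and only its left-hand side has
  a summand offering both \<open>a\<close> and \<open>b\<close>. If \<open>n\<close> exceeds the sizes of all terms in the axioms, then having
  such a summand is invariant under derivations between processes equivalent to \<open>a \<parallel> p\<close>. The critical
  case is an instance under \<open>\<sigma>\<close> of an axiom \<open>t \<approx> u\<close> where the summand comes from a parallel
  composition \<open>v \<parallel> w\<close> in \<open>t\<close>. Then \<open>\<sigma> v\<close> behaves like \<open>a\<close>, \<open>\<sigma> w\<close> has the traces of \<open>p\<close>, and the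
  traces \<open>b a\<^sup>2\<^sup>i b\<close> force \<open>\<sigma> w\<close> to have \<open>n\<close> different \<open>b\<close>-derivatives, so one of them comes from
  a variable \<open>x\<close> occurring at the top level of \<open>w\<close>. Replacing \<open>\<sigma> x\<close> by a long sequence of \<open>b\<close>'s shows
  that \<open>x\<close> occurs at the top level of \<open>u\<close> as well; there it must stand in parallel with something
  that offers \<open>a\<close>, since the \<open>b\<close>-derivatives of \<open>\<sigma> x\<close> lack the parallel \<open>a\<close>.
\<close>

section \<open>Transitions and possible futures\<close>

inductive_simps step_Zero [simp]: "step Zero c r"
inductive_simps step_Var [simp]: "step (Var x) c r"
inductive_simps step_Prefix [simp]: "step (Prefix d p) c r"
inductive_simps step_Plus: "step (Plus p q) c r"
inductive_simps step_Par: "step (Par p q) c r"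
inductive_simps steps_Nil [simp]: "steps p [] r"
inductive_simps steps_Cons [simp]: "steps p (c # \<alpha>) r"

section \<open>Traces and size bounds\<close>

lemma Nil_in_traces [simp]: "[] \<in> traces p"
  by (auto simp: traces_def)

lemma Cons_in_traces: "c # \<alpha> \<in> traces p \<longleftrightarrow> (\<exists>p'. step p c p' \<and> \<alpha> \<in> traces p')"
proof -
  have "(\<exists>r. steps p (c # \<alpha>) r) \<longleftrightarrow> (\<exists>p' r. step p c p' \<and> steps p' \<alpha> r)"
    by (subst steps_Cons) blast
  then show ?thesis by (simp add: traces_def del: steps_Cons)
qed

lemma step_size: "step p c p' \<Longrightarrow> size p' < size p"
  by (induction rule: step.induct) auto

lemma length_trace_le_size: "\<alpha> \<in> traces p \<Longrightarrow> length \<alpha> \<le> size p"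
proof (induction \<alpha> arbitrary: p)
  case (Cons c \<alpha>)
  then obtain p' where "step p c p'" "\<alpha> \<in> traces p'" by (auto simp: Cons_in_traces)
  with Cons.IH[of p'] step_size[of p c p'] show ?case by simp
qed simp

text \<open>Variables have no transitions, so for an open term only the derivatives provided by its
  own prefixes are counted. A term of size below \<open>n\<close> cannot supply \<open>n\<close> of
  them by itself.\<close>

lemma derivatives_bounded: "finite {r. step p c r} \<and> card {r. step p c r} \<le> size p"
proof (induction p)
  case (Prefix d p)
  have sub: "{r. step (Prefix d p) c r} \<subseteq> {p}" by auto
  have "card {r. step (Prefix d p) c r} \<le> 1" using card_mono[OF _ sub] by simp
  then show ?case using finite_subset[OF sub] by (simp del: step_Prefix)
next
  case (Plus p q)
  have eq: "{r. step (Plus p q) c r} = {r. step p c r} \<union> {r. step q c r}"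
    by (auto simp: step_Plus)
  show ?case unfolding eq using Plus card_Un_le[of "{r. step p c r}" "{r. step q c r}"] by simp
next
  case (Par p q)
  have eq: "{r. step (Par p q) c r}
      = (\<lambda>r. Par r q) ` {r. step p c r} \<union> (\<lambda>r. Par p r) ` {r. step q c r}"
    by (auto simp: step_Par)
  have "card {r. step (Par p q) c r} \<le> card {r. step p c r} + card {r. step q c r}"
    unfolding eq using Par
    by (intro order_trans[OF card_Un_le] add_mono card_image_le) auto
  moreover have "finite {r. step (Par p q) c r}" unfolding eq using Par by simp
  ultimately show ?case using Par by simp
qed auto

section \<open>Parallel composition as shuffling of runs\<close>

lemma steps_Par:
  "steps (Par p q) \<alpha> r \<longleftrightarrow>
     (\<exists>\<beta> \<gamma> p' q'. \<alpha> \<in> shuffles \<beta> \<gamma> \<and> steps p \<beta> p' \<and> steps q \<gamma> q' \<and> r = Par p' q')"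
proof (induction \<alpha> arbitrary: p q)
  case Nil
  then show ?case by auto
next
  case (Cons c \<alpha>)
  show ?case
  proof
    assume "steps (Par p q) (c # \<alpha>) r"
    then obtain s where s: "step (Par p q) c s" "steps s \<alpha> r" by auto
    from s(1) consider p1 where "step p c p1" "s = Par p1 q" | q1 where "step q c q1" "s = Par p q1"
      by (auto simp: step_Par)
    then show "\<exists>\<beta> \<gamma> p' q'. c # \<alpha> \<in> shuffles \<beta> \<gamma> \<and> steps p \<beta> p' \<and> steps q \<gamma> q' \<and> r = Par p' q'"
    proof cases
      case 1
      with s(2) Cons obtain \<beta> \<gamma> p' q' where
        "\<alpha> \<in> shuffles \<beta> \<gamma>" "steps p1 \<beta> p'" "steps q \<gamma> q'" "r = Par p' q'" by blast
      with 1 show ?thesis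
        by (intro exI[of _ "c # \<beta>"] exI[of _ \<gamma>]) (auto simp: Cons_in_shuffles_iff)
    next
      case 2
      with s(2) Cons obtain \<beta> \<gamma> p' q' where
        "\<alpha> \<in> shuffles \<beta> \<gamma>" "steps p \<beta> p'" "steps q1 \<gamma> q'" "r = Par p' q'" by blast
      with 2 show ?thesis
        by (intro exI[of _ \<beta>] exI[of _ "c # \<gamma>"]) (auto simp: Cons_in_shuffles_iff)
    qed
  next
    assume "\<exists>\<beta> \<gamma> p' q'. c # \<alpha> \<in> shuffles \<beta> \<gamma> \<and> steps p \<beta> p' \<and> steps q \<gamma> q' \<and> r = Par p' q'"
    then obtain \<beta> \<gamma> p' q' where *: "c # \<alpha> \<in> shuffles \<beta> \<gamma>"
      "steps p \<beta> p'" "steps q \<gamma> q'" "r = Par p' q'" by blast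
    from *(1) consider \<beta>' where "\<beta> = c # \<beta>'" "\<alpha> \<in> shuffles \<beta>' \<gamma>"
      | \<gamma>' where "\<gamma> = c # \<gamma>'" "\<alpha> \<in> shuffles \<beta> \<gamma>'"
      by (cases \<beta>; cases \<gamma>) (auto simp: Cons_in_shuffles_iff)
    then show "steps (Par p q) (c # \<alpha>) r"
    proof cases
      case 1
      with *(2) obtain p1 where "step p c p1" "steps p1 \<beta>' p'" by auto
      moreover have "steps (Par p1 q) \<alpha> r" using Cons 1 * calculation by blast
      ultimately show ?thesis using step.par_left steps.cons by fast
    next
      case 2
      with *(3) obtain q1 where "step q c q1" "steps q1 \<gamma>' q'" by auto
      moreover have "steps (Par p q1) \<alpha> r" using Cons 2 * calculation by blast
      ultimately show ?thesis using step.par_right steps.cons by fast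
    qed
  qed
qed

lemma traces_Par: "traces (Par p q) = (\<Union>\<beta>\<in>traces p. \<Union>\<gamma>\<in>traces q. shuffles \<beta> \<gamma>)"
  unfolding traces_def steps_Par by blast

lemma traces_Par_commute: "traces (Par p q :: ('a, 'v) bccsp) = traces (Par q p)"
proof -
  have "traces (Par p q) \<subseteq> traces (Par q p)" for p q :: "('a, 'v) bccsp"
  proof
    fix \<alpha> assume "\<alpha> \<in> traces (Par p q)"
    then obtain \<beta> \<gamma> where "\<beta> \<in> traces p" "\<gamma> \<in> traces q" "\<alpha> \<in> shuffles \<beta> \<gamma>"
      unfolding traces_Par by blast
    then show "\<alpha> \<in> traces (Par q p)"
      unfolding traces_Par by (auto simp: shuffles_commutes[of \<beta> \<gamma>])
  qed
  from this[of p q] this[of q p] show ?thesis by (rule subset_antisym)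
qed

lemma traces_Par_left: "traces p \<subseteq> traces (Par p q)"
proof
  fix \<alpha> assume "\<alpha> \<in> traces p"
  then show "\<alpha> \<in> traces (Par p q)"
    unfolding traces_Par by (intro UN_I[of \<alpha>] UN_I[of "[]"]) simp_all
qed

lemma traces_Par_right: "traces q \<subseteq> traces (Par p q)"
  using traces_Par_left traces_Par_commute by metis

lemma append_in_shuffles: "xs @ ys \<in> shuffles xs ys"
  by (induction xs) (auto simp: Cons_in_shuffles_iff)

lemma append_traces_Par: "\<alpha> \<in> traces p \<Longrightarrow> \<beta> \<in> traces q \<Longrightarrow> \<alpha> @ \<beta> \<in> traces (Par p q)"
  unfolding traces_Par using append_in_shuffles by blast

lemma traces_Plus: "traces (Plus p q) = traces p \<union> traces q"
proof (rule set_eqI)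
  show "\<alpha> \<in> traces (Plus p q) \<longleftrightarrow> \<alpha> \<in> traces p \<union> traces q" for \<alpha>
    by (cases \<alpha>) (auto simp: Cons_in_traces step_Plus)
qed

lemma possible_futures_Prefix:
  "possible_futures (Prefix c p) =
     insert ([], insert [] ((#) c ` traces p)) ((\<lambda>(\<alpha>, X). (c # \<alpha>, X)) ` possible_futures p)"
proof -
  have T: "traces (Prefix c p) = insert [] ((#) c ` traces p)"
  proof (rule set_eqI)
    show "\<alpha> \<in> traces (Prefix c p) \<longleftrightarrow> \<alpha> \<in> insert [] ((#) c ` traces p)" for \<alpha>
      by (cases \<alpha>) (auto simp: Cons_in_traces)
  qed
  show ?thesis
  proof (rule set_eqI)
    fix e :: "'a list \<times> 'a list set"
    obtain \<alpha> X where "e = (\<alpha>, X)" by fastforce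
    then show "e \<in> possible_futures (Prefix c p) \<longleftrightarrow>
      e \<in> insert ([], insert [] ((#) c ` traces p)) ((\<lambda>(\<alpha>, X). (c # \<alpha>, X)) ` possible_futures p)"
      by (cases \<alpha>) (auto simp: possible_futures_def T)
  qed
qed

lemma possible_futures_Plus:
  "possible_futures (Plus p q) =
     insert ([], traces p \<union> traces q) {e \<in> possible_futures p \<union> possible_futures q. fst e \<noteq> []}"
proof (rule set_eqI)
  fix e :: "'a list \<times> 'a list set"
  obtain \<alpha> X where "e = (\<alpha>, X)" by fastforce
  then show "e \<in> possible_futures (Plus p q) \<longleftrightarrow>
    e \<in> insert ([], traces p \<union> traces q) {e \<in> possible_futures p \<union> possible_futures q. fst e \<noteq> []}"
    by (cases \<alpha>) (auto simp: possible_futures_def traces_Plus step_Plus)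
qed

text \<open>The operands enter only through their possible futures, so equivalence is a congruence
  for \<open>Par\<close>; the two preceding lemmas serve the same purpose for \<open>Prefix\<close>
  and \<open>Plus\<close>.\<close>

lemma possible_futures_Par:
  "possible_futures (Par p q) =
     {(\<alpha>, X). \<exists>\<beta> Y \<gamma> Z. (\<beta>, Y) \<in> possible_futures p \<and> (\<gamma>, Z) \<in> possible_futures q \<and>
        \<alpha> \<in> shuffles \<beta> \<gamma> \<and> X = (\<Union>\<beta>\<in>Y. \<Union>\<gamma>\<in>Z. shuffles \<beta> \<gamma>)}"
proof (intro set_eqI iffI)
  fix e assume "e \<in> possible_futures (Par p q)"
  then obtain \<alpha> \<beta> \<gamma> p' q' where "e = (\<alpha>, traces (Par p' q'))" "\<alpha> \<in> shuffles \<beta> \<gamma>"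
    "steps p \<beta> p'" "steps q \<gamma> q'"
    unfolding possible_futures_def steps_Par by blast
  then show "e \<in> {(\<alpha>, X). \<exists>\<beta> Y \<gamma> Z. (\<beta>, Y) \<in> possible_futures p \<and> (\<gamma>, Z) \<in> possible_futures q \<and>
        \<alpha> \<in> shuffles \<beta> \<gamma> \<and> X = (\<Union>\<beta>\<in>Y. \<Union>\<gamma>\<in>Z. shuffles \<beta> \<gamma>)}"
    unfolding possible_futures_def traces_Par by blast
next
  fix e assume "e \<in> {(\<alpha>, X). \<exists>\<beta> Y \<gamma> Z. (\<beta>, Y) \<in> possible_futures p \<and>
        (\<gamma>, Z) \<in> possible_futures q \<and>
        \<alpha> \<in> shuffles \<beta> \<gamma> \<and> X = (\<Union>\<beta>\<in>Y. \<Union>\<gamma>\<in>Z. shuffles \<beta> \<gamma>)}"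
  then obtain \<alpha> \<beta> \<gamma> p' q' where "e = (\<alpha>, traces (Par p' q'))" "\<alpha> \<in> shuffles \<beta> \<gamma>"
    "steps p \<beta> p'" "steps q \<gamma> q'"
    unfolding possible_futures_def traces_Par by blast
  then show "e \<in> possible_futures (Par p q)"
    unfolding possible_futures_def steps_Par by blast
qed

section \<open>Equivalence in terms of traces and first steps\<close>

lemma traces_eq: "traces p = fst ` possible_futures p"
  by (force simp: traces_def possible_futures_def)

lemma pf_equiv_traces: "p \<sim>PF q \<Longrightarrow> traces p = traces q"
  by (simp add: traces_eq pf_equiv_def)

lemma pf_equiv_step:
  assumes "p \<sim>PF q" "step p c p'"
  obtains q' where "step q c q'" "traces q' = traces p'"
proof -
  have "([c], traces p') \<in> possible_futures p"
    using assms(2) by (auto simp: possible_futures_def)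
  then have "([c], traces p') \<in> possible_futures q"
    using assms(1) by (simp add: pf_equiv_def)
  then show ?thesis using that by (auto simp: possible_futures_def)
qed

lemma pf_equiv_sym: "p \<sim>PF q \<Longrightarrow> q \<sim>PF p"
  by (simp add: pf_equiv_def)

text \<open>Only the possible future after the empty trace concerns the initial state, and its trace
  set is itself determined by the first steps.\<close>

lemma pf_equiv_if_same_steps:
  assumes "\<And>c r. step p c r \<longleftrightarrow> step q c r"
  shows "p \<sim>PF q"
proof -
  have T: "traces p = traces q"
  proof (rule set_eqI)
    show "\<alpha> \<in> traces p \<longleftrightarrow> \<alpha> \<in> traces q" for \<alpha>
      by (cases \<alpha>) (auto simp: Cons_in_traces assms)
  qed
  have "e \<in> possible_futures p \<longleftrightarrow> e \<in> possible_futures q" for e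
    by (cases e; cases "fst e") (auto simp: possible_futures_def assms T)
  then show ?thesis by (auto simp: pf_equiv_def)
qed

text \<open>Variables are inert, so every term is equivalent to the process obtained by replacing them
  by \<open>Zero\<close>; hence soundness on closed substitutions extends to all substitutions, and open terms
  occurring inside derivations need no special treatment.\<close>

abbreviation ground :: "('a, 'v) bccsp \<Rightarrow> ('a, 'v) bccsp" where
  "ground \<equiv> subst (\<lambda>_. Zero)"

lemma step_ground: "step p c p' \<Longrightarrow> step (ground p) c (ground p')"
  by (induction rule: step.induct) (auto intro: step.intros)

lemma step_groundD: "step (ground p) c r \<Longrightarrow> \<exists>p'. r = ground p' \<and> step p c p'"
proof (induction p arbitrary: r)
  case (Plus p q)
  then show ?case unfolding subst.simps step_Plus by blast
next
  case (Par p q)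
  then consider p1 where "step (ground p) c p1" "r = Par p1 (ground q)"
    | q1 where "step (ground q) c q1" "r = Par (ground p) q1" by (auto simp: step_Par)
  then show ?case
  proof cases
    case 1
    with Par.IH(1) obtain p' where "p1 = ground p'" "step p c p'" by blast
    with 1 have "r = ground (Par p' q)" "step (Par p q) c (Par p' q)"
      by (simp_all add: step.par_left)
    then show ?thesis by blast
  next
    case 2
    with Par.IH(2) obtain q' where "q1 = ground q'" "step q c q'" by blast
    with 2 have "r = ground (Par p q')" "step (Par p q) c (Par p q')"
      by (simp_all add: step.par_right)
    then show ?thesis by blast
  qed
qed auto

lemma steps_ground: "steps p \<alpha> p' \<Longrightarrow> steps (ground p) \<alpha> (ground p')"
  by (induction rule: steps.induct) (auto intro: steps.intros step_ground simp del: steps_Cons)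

lemma steps_groundD: "steps (ground p) \<alpha> r \<Longrightarrow> \<exists>p'. r = ground p' \<and> steps p \<alpha> p'"
proof (induction \<alpha> arbitrary: p)
  case Nil
  then show ?case by auto
next
  case (Cons c \<alpha>)
  from Cons.prems obtain s where s: "step (ground p) c s" "steps s \<alpha> r" by auto
  from step_groundD[OF s(1)] obtain p1 where p1: "s = ground p1" "step p c p1" by auto
  from s(2) Cons.IH[of p1] obtain p' where "r = ground p'" "steps p1 \<alpha> p'" unfolding p1(1) by auto
  with steps.cons[OF p1(2)] show ?case by blast
qed

lemma steps_ground_iff: "steps (ground p) \<alpha> r \<longleftrightarrow> (\<exists>p'. r = ground p' \<and> steps p \<alpha> p')"
  using steps_ground steps_groundD by fast

lemma traces_ground: "traces (ground p) = traces p"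
  by (auto simp: traces_def steps_ground_iff)

lemma possible_futures_ground: "possible_futures (ground p) = possible_futures p"
  by (auto simp: possible_futures_def steps_ground_iff traces_ground)

lemma ground_subst: "ground (subst \<sigma> t) = subst (\<lambda>x. ground (\<sigma> x)) t"
  by (induction t) auto

lemma sound_eq_subst:
  assumes "sound_eq pf_equiv (t, u)"
  shows "subst \<sigma> t \<sim>PF subst \<sigma> u"
proof -
  have "is_closed (ground (\<sigma> x))" for x
    by (rule subst_closed) (simp add: closed_subst_def is_closed_def)
  then have "closed_subst (\<lambda>x. ground (\<sigma> x))"
    by (simp add: closed_subst_def)
  then have "ground (subst \<sigma> t) \<sim>PF ground (subst \<sigma> u)"
    using assms by (simp add: sound_eq_def ground_subst)
  then show ?thesis by (simp add: pf_equiv_def possible_futures_ground)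
qed

lemma derivable_pf_equiv:
  assumes "sound pf_equiv E" "derivable E t u"
  shows "t \<sim>PF u"
  using assms(2)
proof induction
  case (inst t u \<sigma>)
  then show ?case using assms(1) sound_eq_subst by (auto simp: sound_def)
next
  case (prefix t u c)
  then show ?case using pf_equiv_traces[of t u] by (simp add: pf_equiv_def possible_futures_Prefix)
next
  case (plus t u t' u')
  then show ?case using pf_equiv_traces[of t u] pf_equiv_traces[of t' u']
    by (simp add: pf_equiv_def possible_futures_Plus)
next
  case (par t u t' u')
  then show ?case by (simp add: pf_equiv_def possible_futures_Par)
qed (auto simp: pf_equiv_def)

section \<open>Inert terms and variables at the top level\<close>

definition inert :: "('a, 'v) bccsp \<Rightarrow> bool" where
  "inert p \<longleftrightarrow> (\<forall>c r. \<not> step p c r)"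

lemma inert_iff_traces: "inert p \<longleftrightarrow> traces p = {[]}"
proof
  assume i: "inert p"
  have "\<alpha> = []" if "\<alpha> \<in> traces p" for \<alpha>
    using that i by (cases \<alpha>) (auto simp: Cons_in_traces inert_def)
  then show "traces p = {[]}" by auto
next
  assume "traces p = {[]}"
  then have "[c] \<notin> traces p" for c by simp
  then show "inert p" by (auto simp: inert_def Cons_in_traces)
qed

lemma traces_Par_inert:
  "inert q \<Longrightarrow> traces (Par p q) = traces p"
  "inert p \<Longrightarrow> traces (Par p q) = traces q"
  by (auto simp: inert_iff_traces traces_Par)

text \<open>Exposed variables are those whose values contribute their own transitions to the first
  steps of an instance.\<close>

primrec exposed :: "'v \<Rightarrow> ('a, 'v) bccsp \<Rightarrow> bool" where
  "exposed x Zero \<longleftrightarrow> False"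
| "exposed x (Var y) \<longleftrightarrow> x = y"
| "exposed x (Prefix c t) \<longleftrightarrow> False"
| "exposed x (Plus t u) \<longleftrightarrow> exposed x t \<or> exposed x u"
| "exposed x (Par t u) \<longleftrightarrow> exposed x t \<or> exposed x u"

lemma exposed_step:
  "exposed x t \<Longrightarrow> step (\<sigma> x) c r \<Longrightarrow> \<exists>r'. step (subst \<sigma> t) c r'"
proof (induction t)
  case (Plus t u)
  then show ?case using step.plus_left step.plus_right unfolding subst.simps exposed.simps by metis
next
  case (Par t u)
  then show ?case using step.par_left step.par_right unfolding subst.simps exposed.simps by metis
qed auto

text \<open>\<open>\<delta>\<close> runs through the prefixes guarding one occurrence of
  \<open>x\<close>; afterwards the value of \<open>x\<close> is still untouched, so one
  \<open>\<delta>\<close> serves all its traces.\<close>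

lemma traces_reach_var:
  "x \<in> vars t \<Longrightarrow> \<exists>\<delta>. \<forall>\<tau>\<in>traces (\<sigma> x). \<delta> @ \<tau> \<in> traces (subst \<sigma> t)"
proof (induction t)
  case (Var y)
  then show ?case by (auto intro: exI[of _ "[]"])
next
  case (Prefix c t)
  then obtain \<delta> where "\<forall>\<tau>\<in>traces (\<sigma> x). \<delta> @ \<tau> \<in> traces (subst \<sigma> t)" by auto
  then show ?case by (intro exI[of _ "c # \<delta>"]) (auto simp: Cons_in_traces)
next
  case (Plus t u)
  then show ?case unfolding subst.simps traces_Plus bccsp.set by blast
next
  case (Par t u)
  then show ?case
    using traces_Par_left[of "subst \<sigma> t" "subst \<sigma> u"] traces_Par_right[of "subst \<sigma> u" "subst \<sigma> t"]
    unfolding subst.simps bccsp.set by blast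
qed auto

lemma subst_fun_upd_other: "x \<notin> vars t \<Longrightarrow> subst (\<sigma>(x := p)) t = subst \<sigma> t"
  by (induction t) simp_all

lemma not_in_vars_inert:
  assumes "inert (subst \<sigma> t)" "step (\<sigma> x) c r"
  shows "x \<notin> vars t"
proof
  assume "x \<in> vars t"
  from traces_reach_var[OF this, of \<sigma>] obtain \<delta>
    where \<delta>: "\<forall>\<tau>\<in>traces (\<sigma> x). \<delta> @ \<tau> \<in> traces (subst \<sigma> t)" ..
  have "[c] \<in> traces (\<sigma> x)" unfolding Cons_in_traces using assms(2) Nil_in_traces by blast
  with \<delta> have "\<delta> @ [c] \<in> traces (subst \<sigma> t)" ..
  then show False using assms(1) by (simp add: inert_iff_traces)
qed

definition path :: "'a list \<Rightarrow> ('a, 'v) bccsp" where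
  "path w = foldr Prefix w Zero"

lemma path_simps [simp]: "path [] = Zero" "path (c # w) = Prefix c (path w)"
  by (simp_all add: path_def)

lemma path_closed: "is_closed (path w)"
  by (induction w) (auto simp: is_closed_def)

lemma traces_path: "\<alpha> \<in> traces (path w) \<longleftrightarrow> (\<exists>\<beta>. w = \<alpha> @ \<beta>)"
proof (induction w arbitrary: \<alpha>)
  case Nil
  then show ?case by (cases \<alpha>) (auto simp: Cons_in_traces)
next
  case (Cons c w)
  then show ?case by (cases \<alpha>) (auto simp: Cons_in_traces)
qed

text \<open>If an occurrence of \<open>x\<close> survives the step, its copy of \<open>p\<close> has
  not moved, since \<open>x\<close> is not exposed, and all its traces remain reachable. Otherwise
  the derivative is built without \<open>p\<close>, which bounds its size independently of
  \<open>p\<close>.\<close>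

lemma unexposed_step:
  assumes "\<not> exposed x t" "step (subst (\<sigma>(x := p)) t) c r"
  shows "(\<exists>\<delta>. \<forall>\<tau>\<in>traces p. \<delta> @ \<tau> \<in> traces r) \<or> size r < size (subst \<sigma> t)"
proof -
  define \<rho> where "\<rho> = \<sigma>(x := p)"
  have \<rho>x: "\<rho> x = p" and \<rho>y: "y \<noteq> x \<Longrightarrow> \<rho> y = \<sigma> y" for y by (simp_all add: \<rho>_def)
  have other: "subst \<rho> v = subst \<sigma> v" if "x \<notin> vars v" for v
    using that by (simp add: \<rho>_def subst_fun_upd_other)
  have reach: "\<exists>\<delta>. \<forall>\<tau>\<in>traces p. \<delta> @ \<tau> \<in> traces (subst \<rho> v)" if "x \<in> vars v" for v
    using traces_reach_var[OF that, of \<rho>] by (simp add: \<rho>x)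
  show ?thesis
    using assms unfolding \<rho>_def[symmetric]
  proof (induction t arbitrary: r)
    case (Prefix d t)
    then have r: "r = subst \<rho> t" by simp
    show ?case
    proof (cases "x \<in> vars t")
      case True
      then show ?thesis using reach r by blast
    next
      case False
      then show ?thesis using r by (simp add: other)
    qed
  next
    case (Var y)
    then show ?case using step_size[of "\<sigma> y" c r] \<rho>y[of y] by auto
  next
    case (Plus t u)
    then have "step (subst \<rho> t) c r \<or> step (subst \<rho> u) c r"
      by (simp add: step_Plus)
    then show ?case
    proof
      assume "step (subst \<rho> t) c r"
      with Plus.IH(1)[of r] Plus.prems(1) show ?thesis by auto
    next
      assume "step (subst \<rho> u) c r"
      with Plus.IH(2)[of r] Plus.prems(1) show ?thesis by auto
    qed
  next
    case (Par t u)
    from Par.prems consider t1 where "step (subst \<rho> t) c t1" "r = Par t1 (subst \<rho> u)"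
      | u1 where "step (subst \<rho> u) c u1" "r = Par (subst \<rho> t) u1" by (auto simp: step_Par)
    then show ?case
    proof cases
      case 1
      note sub = traces_Par_left[of t1 "subst \<rho> u"] traces_Par_right[of "subst \<rho> u" t1]
      show ?thesis
      proof (cases "x \<in> vars u")
        case True
        with reach 1 sub show ?thesis by blast
      next
        case False
        then have u: "subst \<rho> u = subst \<sigma> u" by (rule other)
        have "(\<exists>\<delta>. \<forall>\<tau>\<in>traces p. \<delta> @ \<tau> \<in> traces t1) \<or> size t1 < size (subst \<sigma> t)"
          using Par 1 by simp
        then show ?thesis using 1 sub u by auto
      qed
    next
      case 2
      note sub = traces_Par_right[of u1 "subst \<rho> t"] traces_Par_left[of "subst \<rho> t" u1]
      show ?thesis
      proof (cases "x \<in> vars t")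
        case True
        with reach 2 sub show ?thesis by blast
      next
        case False
        then have t: "subst \<rho> t = subst \<sigma> t" by (rule other)
        have "(\<exists>\<delta>. \<forall>\<tau>\<in>traces p. \<delta> @ \<tau> \<in> traces u1) \<or> size u1 < size (subst \<sigma> u)"
          using Par 2 by simp
        then show ?thesis using 2 sub t by auto
      qed
    qed
  qed auto
qed

section \<open>The expansion law and its critical summand\<close>

locale two_actions =
  fixes a b :: 'a
  assumes neq: "a \<noteq> b"
begin

text \<open>The even exponents make \<open>a\<^sup>2\<^sup>i b\<close> a trace of \<open>a \<parallel> branch k\<close> only for \<open>i = k\<close>.\<close>

definition branch :: "nat \<Rightarrow> ('a, 'v) bccsp" where
  "branch i = path (replicate (2 * i) a @ [b])"

primrec choice :: "nat \<Rightarrow> ('a, 'v) bccsp" where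
  "choice 0 = Zero"
| "choice (Suc n) = Plus (choice n) (Prefix b (branch (Suc n)))"

primrec expansion :: "nat \<Rightarrow> ('a, 'v) bccsp" where
  "expansion 0 = Zero"
| "expansion (Suc n) = Plus (expansion n) (Prefix b (Par (Prefix a Zero) (branch (Suc n))))"

lemma step_choice: "step (choice n) c r \<longleftrightarrow> c = b \<and> (\<exists>i\<in>{1..n}. r = branch i)"
  by (induction n) (auto simp: step_Plus atLeastAtMostSuc_conv)

lemma step_expansion:
  "step (expansion n) c r \<longleftrightarrow> c = b \<and> (\<exists>i\<in>{1..n}. r = Par (Prefix a Zero) (branch i))"
  by (induction n) (auto simp: step_Plus atLeastAtMostSuc_conv)

lemma choice_closed: "is_closed (choice n)"
  by (induction n) (simp_all add: is_closed_def branch_def path_closed[unfolded is_closed_def])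

lemma expansion_closed: "is_closed (expansion n)"
  by (induction n) (simp_all add: is_closed_def branch_def path_closed[unfolded is_closed_def])

text \<open>\<open>Par Zero (choice n)\<close> stays unsimplified on the right, so that both sides
  have literally the same transitions.\<close>

lemma expansion_law:
  "Par (Prefix a Zero) (choice n) \<sim>PF Plus (Prefix a (Par Zero (choice n))) (expansion n)"
  by (rule pf_equiv_if_same_steps) (auto simp: step_Par step_Plus step_choice step_expansion)

lemma single_b_notin_traces_branch: "1 \<le> i \<Longrightarrow> [b] \<notin> traces (branch i)"
  using neq by (cases i) (auto simp: branch_def Cons_in_traces)

lemma single_b_notin_traces_Par_branch: "1 \<le> i \<Longrightarrow> [b] \<notin> traces (Par (Prefix a Zero) (branch i))"
  using neq by (cases i) (auto simp: branch_def Cons_in_traces step_Par)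

lemma traces_choice_Cons:
  "c # \<alpha> \<in> traces (choice n :: ('a, 'v) bccsp) \<longleftrightarrow>
     c = b \<and> (\<exists>i\<in>{1..n}. \<alpha> \<in> traces (branch i :: ('a, 'v) bccsp))"
  by (auto simp: Cons_in_traces step_choice)

lemma traces_Prefix_a_Zero: "traces (Prefix a Zero :: ('a, 'v) bccsp) = {[], [a]}"
proof (rule set_eqI)
  fix \<alpha> show "\<alpha> \<in> traces (Prefix a Zero :: ('a, 'v) bccsp) \<longleftrightarrow> \<alpha> \<in> {[], [a]}"
    using inert_iff_traces[of Zero] by (cases \<alpha>) (auto simp: Cons_in_traces inert_def)
qed

text \<open>The final \<open>b\<close> can only stem from the end of the branch, so the branch is
  executed completely and yields \<open>2 * k\<close> letters \<open>a\<close>; the left factor adds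
  at most one more.\<close>

lemma marker_in_traces_Par_branch:
  "replicate m a @ [b] \<in> traces (Par (Prefix a Zero) (branch k :: ('a, 'v) bccsp)) \<longleftrightarrow> m = 2 * k \<or> m = Suc (2 * k)"
    (is "?w m \<in> _ \<longleftrightarrow> _")
proof
  assume "?w m \<in> traces (Par (Prefix a Zero) (branch k :: ('a, 'v) bccsp))"
  then obtain \<beta> \<gamma> where s: "?w m \<in> shuffles \<beta> \<gamma>" and \<beta>: "\<beta> \<in> {[], [a]}"
    and \<gamma>: "\<gamma> \<in> traces (branch k :: ('a, 'v) bccsp)"
    unfolding traces_Par traces_Prefix_a_Zero by blast
  from \<gamma> obtain \<delta> where \<delta>: "?w (2 * k) = \<gamma> @ \<delta>" by (auto simp: branch_def traces_path)
  have "set \<beta> \<subseteq> {a}" using \<beta> by auto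
  moreover have "set (?w m) = set \<beta> \<union> set \<gamma>" using s by (rule set_shuffles)
  moreover have "b \<in> set (?w m)" by simp
  ultimately have "b \<in> set \<gamma>" using neq by blast
  \<comment> \<open>The only \<open>b\<close> of the path is its last letter, so a prefix containing
    \<open>b\<close> is the whole path.\<close>
  have "\<delta> = []"
  proof (cases \<delta> rule: rev_cases)
    case (snoc \<delta>' c)
    with \<delta> have "replicate (2 * k) a = \<gamma> @ \<delta>'" by simp
    then have "set \<gamma> \<union> set \<delta>' \<subseteq> {a}"
      by (metis set_append set_replicate_conv_if empty_subsetI subset_refl)
    with \<open>b \<in> set \<gamma>\<close> neq show ?thesis by auto
  qed
  then have "length \<gamma> = Suc (2 * k)" using arg_cong[OF \<delta>, of length] by simp
  moreover have "Suc m = length \<beta> + length \<gamma>" using length_shuffles[OF s] by simp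
  ultimately show "m = 2 * k \<or> m = Suc (2 * k)" using \<beta> by auto
next
  have w: "?w (2 * k) \<in> traces (branch k :: ('a, 'v) bccsp)" by (simp add: branch_def traces_path)
  assume "m = 2 * k \<or> m = Suc (2 * k)"
  then show "?w m \<in> traces (Par (Prefix a Zero) (branch k :: ('a, 'v) bccsp))"
  proof
    assume "m = 2 * k"
    then show ?thesis using w traces_Par_right by blast
  next
    assume "m = Suc (2 * k)"
    then show ?thesis
      using append_traces_Par[of "[a]" "Prefix a Zero", OF _ w] by (simp add: traces_Prefix_a_Zero)
  qed
qed

text \<open>The part of equivalence to \<open>a \<parallel> choice n\<close> that is inherited by summands.\<close>

definition below :: "nat \<Rightarrow> ('a, 'v) bccsp \<Rightarrow> bool" where
  "below n p \<longleftrightarrow> (\<forall>c r. step p c r \<longrightarrow>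
     c = a \<and> traces r = traces (choice n :: ('a, 'v) bccsp) \<or>
     c = b \<and> (\<exists>i\<in>{1..n}. traces r = traces (Par (Prefix a Zero) (branch i) :: ('a, 'v) bccsp)))"

text \<open>Some summand offers both \<open>a\<close> and \<open>b\<close>. Inert parallel factors are skipped because the law
  \<open>x \<parallel> 0 \<approx> x\<close> would otherwise turn any sum into a single summand.\<close>

primrec mixed :: "('a, 'v) bccsp \<Rightarrow> bool" where
  "mixed Zero \<longleftrightarrow> False"
| "mixed (Var x) \<longleftrightarrow> False"
| "mixed (Prefix c p) \<longleftrightarrow> False"
| "mixed (Plus p q) \<longleftrightarrow> mixed p \<or> mixed q"
| "mixed (Par p q) \<longleftrightarrow>
     (if inert q then mixed p else if inert p then mixed q
      else (\<forall>c\<in>{a, b}. \<exists>r. step (Par p q) c r))"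

section \<open>Inheritance of \<open>below\<close>\<close>

lemma belowI:
  fixes p :: "('a, 'v) bccsp"
  assumes "\<And>c r. step p c r \<Longrightarrow>
     c = a \<and> traces r = traces (choice n :: ('a, 'v) bccsp) \<or>
     c = b \<and> (\<exists>i\<in>{1..n}. traces r = traces (Par (Prefix a Zero) (branch i) :: ('a, 'v) bccsp))"
  shows "below n p"
  unfolding below_def using assms by blast

lemma belowD:
  fixes p :: "('a, 'v) bccsp"
  assumes "below n p" "step p c r"
  shows "c = a \<and> traces r = traces (choice n :: ('a, 'v) bccsp) \<or>
     c = b \<and> (\<exists>i\<in>{1..n}. traces r = traces (Par (Prefix a Zero) (branch i) :: ('a, 'v) bccsp))"
  using assms unfolding below_def by blast

lemma belowD_a:
  fixes p :: "('a, 'v) bccsp"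
  shows "below n p \<Longrightarrow> step p a r \<Longrightarrow> traces r = traces (choice n :: ('a, 'v) bccsp)"
  using belowD[of n p a r] neq by blast

lemma belowD_b:
  fixes p :: "('a, 'v) bccsp"
  assumes "below n p" "step p b r"
  obtains i where "1 \<le> i" "i \<le> n"
    "traces r = traces (Par (Prefix a Zero) (branch i) :: ('a, 'v) bccsp)"
proof -
  from belowD[OF assms] neq obtain i where "i \<in> {1..n}"
    "traces r = traces (Par (Prefix a Zero) (branch i) :: ('a, 'v) bccsp)" by blast
  then show ?thesis using that[of i] by simp
qed

lemma below_mono:
  fixes p q :: "('a, 'v) bccsp"
  assumes "below n p" "\<And>c r. step q c r \<Longrightarrow> \<exists>r'. step p c r' \<and> traces r' = traces r"
  shows "below n q"
proof (rule belowI)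
  fix c r assume "step q c r"
  from assms(2)[OF this] obtain r' where "step p c r'" "traces r' = traces r" by blast
  with belowD[OF assms(1) this(1)] show "c = a \<and> traces r = traces (choice n :: ('a, 'v) bccsp) \<or>
     c = b \<and> (\<exists>i\<in>{1..n}. traces r = traces (Par (Prefix a Zero) (branch i) :: ('a, 'v) bccsp))"
    by simp
qed

lemma below_cong:
  assumes "p \<sim>PF q" "below n p"
  shows "below n q"
  using assms(2)
proof (rule below_mono)
  fix c r assume "step q c r"
  then obtain r' where "step p c r'" "traces r' = traces r"
    by (rule pf_equiv_step[OF pf_equiv_sym[OF assms(1)]])
  then show "\<exists>r'. step p c r' \<and> traces r' = traces r" by auto
qed

lemma below_Plus: "below n (Plus p q :: ('a, 'v) bccsp) \<longleftrightarrow> below n p \<and> below n q"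
proof
  assume B: "below n (Plus p q)"
  show "below n p \<and> below n q"
  proof
    show "below n p" using B by (rule below_mono) (auto intro: step.plus_left)
    show "below n q" using B by (rule below_mono) (auto intro: step.plus_right)
  qed
next
  assume B: "below n p \<and> below n q"
  show "below n (Plus p q)"
  proof (rule belowI)
    fix c r assume "step (Plus p q) c r"
    then have "step p c r \<or> step q c r" by (simp add: step_Plus)
    then show "c = a \<and> traces r = traces (choice n :: ('a, 'v) bccsp) \<or>
      c = b \<and> (\<exists>i\<in>{1..n}. traces r = traces (Par (Prefix a Zero) (branch i) :: ('a, 'v) bccsp))"
      using belowD[of n p c r] belowD[of n q c r] B by (elim disjE) simp_all
  qed
qed

lemma below_Par_inert:
  assumes B: "below n (Par p q)"
  shows "inert q \<Longrightarrow> below n p" "inert p \<Longrightarrow> below n q"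
proof -
  show "below n p" if i: "inert q"
    using B by (rule below_mono) (auto intro!: exI step.par_left simp: traces_Par_inert(1)[OF i])
  show "below n q" if i: "inert p"
    using B by (rule below_mono) (auto intro!: exI step.par_right simp: traces_Par_inert(2)[OF i])
qed

lemma below_Par_commute: "below n (Par p q) \<Longrightarrow> below n (Par q p)"
proof (erule below_mono)
  fix c r assume "step (Par q p) c r"
  then consider q' where "r = Par q' p" "step q c q'" | p' where "r = Par q p'" "step p c p'"
    by (auto simp: step_Par)
  then show "\<exists>r'. step (Par p q) c r' \<and> traces r' = traces r"
  proof cases
    case 1
    from step.par_right[OF 1(2), of p] traces_Par_commute[of p q'] show ?thesis unfolding 1(1) by auto
  next
    case 2
    from step.par_left[OF 2(2), of q] traces_Par_commute[of p' q] show ?thesis unfolding 2(1) by auto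
  qed
qed

text \<open>Every admissible branch starts with \<open>a\<close>. Consequently two parallel factors
  cannot both offer \<open>b\<close>, as one \<open>b\<close> would remain possible after the
  other.\<close>

lemma below_b_not_b:
  assumes "below n p" "step p b r"
  shows "[b] \<notin> traces r"
proof -
  from assms obtain i where "1 \<le> i"
    "traces r = traces (Par (Prefix a Zero) (branch i) :: ('a, 'b) bccsp)" by (rule belowD_b)
  then show ?thesis by (simp only: single_b_notin_traces_Par_branch not_False_eq_True)
qed

section \<open>Initial actions and preservation of \<open>mixed\<close>\<close>

lemma mixed_steps: "mixed p \<Longrightarrow> c \<in> {a, b} \<Longrightarrow> \<exists>r. step p c r"
proof (induction p)
  case (Plus p q)
  then show ?case by (auto simp: step_Plus)
next
  case (Par p q)
  from Par.prems(1) consider "mixed p" | "mixed q" | "\<forall>c\<in>{a, b}. \<exists>r. step (Par p q) c r"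
    by (auto split: if_splits)
  then show ?case
  proof cases
    case 1
    with Par show ?thesis using step.par_left[of p c _ q] by blast
  next
    case 2
    with Par show ?thesis using step.par_right[of q c _ p] by blast
  next
    case 3
    then show ?thesis using Par.prems(2) by blast
  qed
qed auto

lemma mixed_not_inert: "mixed p \<Longrightarrow> \<not> inert p"
  using mixed_steps[of p a] by (auto simp: inert_def)

lemma mixed_ParI:
  assumes "\<not> inert p" "\<not> inert q"
    "(\<exists>r. step p a r) \<or> (\<exists>r. step q a r)" "(\<exists>r. step p b r) \<or> (\<exists>r. step q b r)"
  shows "mixed (Par p q)"
  using assms unfolding mixed.simps step_Par by auto

lemma mixed_Par_commute: "mixed (Par p q) \<longleftrightarrow> mixed (Par q p)"
proof -
  have "inert p \<Longrightarrow> inert q \<Longrightarrow> mixed p = mixed q" using mixed_not_inert by blast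
  moreover have "(\<exists>r. step (Par p q) c r) \<longleftrightarrow> (\<exists>r. step (Par q p) c r)" for c
    unfolding step_Par by blast
  ultimately show ?thesis by simp
qed

text \<open>At a \<open>Par\<close> node, a mixed factor beside a non-inert one offers both actions
  by itself; beside an inert one it is passed on by definition.\<close>

lemma exposed_mixed:
  assumes "exposed x t" "mixed (\<sigma> x)"
  shows "mixed (subst \<sigma> t)"
  using assms
proof (induction t)
  case (Par t u)
  have "mixed (Par p q)" if m: "mixed p" for p q :: "('a, 'v) bccsp"
  proof (cases "inert q")
    case False
    then show ?thesis using m mixed_not_inert mixed_steps by (intro mixed_ParI) auto
  qed (simp add: m)
  from this[of "subst \<sigma> t" "subst \<sigma> u"] this[of "subst \<sigma> u" "subst \<sigma> t"] Par show ?case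
    unfolding subst.simps exposed.simps mixed_Par_commute[of "subst \<sigma> u"] by blast
qed auto

text \<open>As long as \<open>x\<close> meets only inert parallel factors, its
  \<open>b\<close>-derivative survives up to traces. A non-inert factor beside it cannot offer
  \<open>b\<close>, by \<open>below_b_not_b\<close>, hence offers \<open>a\<close>, and the
  composition is mixed.\<close>

lemma exposed_mixed_or_step:
  assumes "exposed x t" "step (\<sigma> x) b r" "below n (subst \<sigma> t)"
  shows "mixed (subst \<sigma> t) \<or> (\<exists>r'. step (subst \<sigma> t) b r' \<and> traces r' = traces r)"
  using assms
proof (induction t)
  case (Plus t u)
  then show ?case unfolding subst.simps exposed.simps below_Plus step_Plus mixed.simps by blast
next
  case (Par t u)
  \<comment> \<open>Here \<open>p\<close> is the factor in which \<open>x\<close> is exposed;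
    \<open>s\<close> merely witnesses that \<open>p\<close> offers \<open>b\<close>.\<close>
  have main: "mixed (Par p q) \<or> (\<exists>r'. step (Par p q) b r' \<and> traces r' = traces r)"
    if B: "below n (Par p q)" and p: "step p b s"
      and IH: "below n p \<Longrightarrow> mixed p \<or> (\<exists>r'. step p b r' \<and> traces r' = traces r)"
    for p q s :: "('a, 'v) bccsp"
  proof (cases "inert q")
    case True
    then have "mixed p \<or> (\<exists>r'. step p b r' \<and> traces r' = traces r)"
      using B below_Par_inert IH by blast
    moreover have "mixed (Par p q) \<longleftrightarrow> mixed p" using True by simp
    ultimately show ?thesis using traces_Par_inert(1)[OF True] step.par_left[of p b _ q] by blast
  next
    case False
    then obtain c s' where q: "step q c s'" by (auto simp: inert_def)
    have "step (Par p q) b (Par s q)" using p by (rule step.par_left)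
    then have "[b] \<notin> traces (Par s q)" using B below_b_not_b by blast
    then have "[b] \<notin> traces q" using traces_Par_right by blast
    then have "c \<noteq> b" using q Nil_in_traces unfolding Cons_in_traces by blast
    then have "step q a s'" using belowD[OF B step.par_right[OF q]] q by blast
    moreover have "\<not> inert p" using p by (auto simp: inert_def)
    ultimately show ?thesis using p False mixed_ParI[of p q] by blast
  qed
  from Par.prems(1) consider "exposed x t" | "exposed x u" by auto
  then show ?case
  proof cases
    case 1
    from exposed_step[of x _ \<sigma>, OF this Par.prems(2)] obtain s where "step (subst \<sigma> t) b s" ..
    from main[OF _ this, of "subst \<sigma> u"] 1 Par.IH(1) Par.prems show ?thesis by simp
  next
    case 2
    from exposed_step[of x _ \<sigma>, OF this Par.prems(2)] obtain s where "step (subst \<sigma> u) b s" ..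
    moreover have "below n (Par (subst \<sigma> u) (subst \<sigma> t))"
      using Par.prems(3) below_Par_commute by simp
    ultimately have "mixed (Par (subst \<sigma> u) (subst \<sigma> t)) \<or>
      (\<exists>r'. step (Par (subst \<sigma> u) (subst \<sigma> t)) b r' \<and> traces r' = traces r)"
      using main 2 Par.IH(2) Par.prems(2) by blast
    moreover have "\<exists>r'. step (Par p q) b r' \<and> traces r' = traces r"
      if "step (Par q p) b r'" "traces r' = traces r" for p q r' :: "('a, 'v) bccsp"
    proof -
      from that(1) consider q' where "r' = Par q' p" "step q b q'"
        | p' where "r' = Par q p'" "step p b p'" by (auto simp: step_Par)
      then show ?thesis using that(2) step.par_left[of p b _ q] step.par_right[of q b _ p]
        by cases (auto simp: traces_Par_commute[of q] traces_Par_commute[of _ p])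
    qed
    ultimately show ?thesis
      unfolding subst.simps mixed_Par_commute[of "subst \<sigma> t"] by blast
  qed
qed auto

section \<open>Detecting variables by long traces\<close>

abbreviation bcount :: "'a list \<Rightarrow> nat" where
  "bcount \<tau> \<equiv> length (filter ((=) b) \<tau>)"

lemma bcount_shuffles:
  assumes "\<alpha> \<in> shuffles \<beta> \<gamma>"
  shows "bcount \<alpha> = bcount \<beta> + bcount \<gamma>"
proof -
  have "filter ((=) b) \<alpha> \<in> shuffles (filter ((=) b) \<beta>) (filter ((=) b) \<gamma>)"
    using assms filter_shuffles[of "(=) b" \<beta> \<gamma>] by blast
  then show ?thesis by (rule length_shuffles)
qed

text \<open>The upper bound counts only \<open>b\<close>, since parallel factors may add other
  letters; the lower bound is compared with term sizes and so uses the full length.\<close>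

definition probe :: "('v \<Rightarrow> ('a, 'v) bccsp) \<Rightarrow> 'v \<Rightarrow> nat \<Rightarrow> ('a, 'v) bccsp \<Rightarrow> bool" where
  "probe \<sigma> x M t \<longleftrightarrow> (\<exists>r. step (subst (\<sigma>(x := path (replicate (Suc M) b))) t) b r \<and>
     (\<forall>\<tau>\<in>traces r. bcount \<tau> \<le> M) \<and> (\<exists>\<tau>\<in>traces r. M \<le> length \<tau>))"

text \<open>The first step consumes one \<open>b\<close> of the sequence substituted for \<open>x\<close>. If \<open>x\<close> is not at the top
  level, the sequence is either still complete (\<open>Suc M\<close> occurrences of \<open>b\<close>) or lost (short traces).\<close>

lemma probe_Var: "probe \<sigma> x M (Var x)"
proof -
  have "bcount \<tau> \<le> M" if t: "\<tau> \<in> traces (path (replicate M b) :: ('a, 'v) bccsp)" for \<tau>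
  proof -
    from t obtain \<beta> where "replicate M b = \<tau> @ \<beta>" by (auto simp: traces_path)
    then have "length \<tau> \<le> M" by (metis length_append length_replicate le_add1)
    then show ?thesis using length_filter_le order_trans by blast
  qed
  moreover have "replicate M b \<in> traces (path (replicate M b) :: ('a, 'v) bccsp)"
    by (simp add: traces_path)
  ultimately show ?thesis
    unfolding probe_def by (intro exI[of _ "path (replicate M b)"]) force
qed

lemma probe_Plus: "probe \<sigma> x M t \<or> probe \<sigma> x M u \<Longrightarrow> probe \<sigma> x M (Plus t u)"
  unfolding probe_def subst.simps step_Plus by blast

text \<open>A factor without \<open>x\<close> is unaffected by the substituted sequence; unable to
  perform \<open>b\<close>, it cannot raise the count, and the long trace remains available beside
  it.\<close>

lemma probe_Par:
  assumes "probe \<sigma> x M t" "x \<notin> vars u" "\<And>\<gamma>. \<gamma> \<in> traces (subst \<sigma> u) \<Longrightarrow> b \<notin> set \<gamma>"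
  shows "probe \<sigma> x M (Par t u)" "probe \<sigma> x M (Par u t)"
proof -
  let ?\<rho> = "\<sigma>(x := path (replicate (Suc M) b))"
  from assms(1) obtain r where r: "step (subst ?\<rho> t) b r" "\<And>\<tau>. \<tau> \<in> traces r \<Longrightarrow> bcount \<tau> \<le> M"
    "\<exists>\<tau>\<in>traces r. M \<le> length \<tau>" unfolding probe_def by blast
  have u: "subst ?\<rho> u = subst \<sigma> u" using assms(2) by (rule subst_fun_upd_other)
  have "bcount \<tau> \<le> M" if "\<tau> \<in> traces (Par r (subst \<sigma> u))" for \<tau>
  proof -
    from that obtain \<beta> \<gamma> where *: "\<tau> \<in> shuffles \<beta> \<gamma>" "\<beta> \<in> traces r" "\<gamma> \<in> traces (subst \<sigma> u)"
      unfolding traces_Par by blast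
    have "bcount \<gamma> = 0" using assms(3)[OF *(3)] by (auto simp: filter_empty_conv)
    then show ?thesis using bcount_shuffles[OF *(1)] r(2)[OF *(2)] by simp
  qed
  moreover have "\<exists>\<tau>\<in>traces (Par r (subst \<sigma> u)). M \<le> length \<tau>"
    using r(3) traces_Par_left by blast
  ultimately have *: "(\<forall>\<tau>\<in>traces (Par r (subst \<sigma> u)). bcount \<tau> \<le> M) \<and>
    (\<exists>\<tau>\<in>traces (Par r (subst \<sigma> u)). M \<le> length \<tau>)" by blast
  show "probe \<sigma> x M (Par t u)"
    unfolding probe_def subst.simps u using step.par_left[OF r(1)] * by blast
  show "probe \<sigma> x M (Par u t)"
    unfolding probe_def subst.simps u
    using step.par_right[OF r(1)] *[unfolded traces_Par_commute[of r]] by blast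
qed

lemma probe_Par_inert:
  assumes "probe \<sigma> x M t" "inert (subst \<sigma> u)" "step (\<sigma> x) c r"
  shows "probe \<sigma> x M (Par t u)" "probe \<sigma> x M (Par u t)"
  using probe_Par[OF assms(1) not_in_vars_inert[OF assms(2,3)]] assms(2)
  by (auto simp: inert_iff_traces)

text \<open>Equivalence carries the trace set of the probing derivative over to \<open>u\<close>. If
  \<open>x\<close> is not exposed there, \<open>unexposed_step\<close> allows only derivatives with
  too many \<open>b\<close> or too short traces.\<close>

lemma exposed_if_probe:
  assumes "\<And>\<sigma>. subst \<sigma> t \<sim>PF subst \<sigma> u" "\<And>M. probe \<sigma> x M t"
  shows "exposed x u"
proof (rule ccontr)
  assume "\<not> exposed x u"
  \<comment> \<open>The size is taken under the unchanged \<open>\<sigma>\<close>, as in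
    \<open>unexposed_step\<close>, so it does not depend on the sequence whose length it
    determines.\<close>
  define M where "M = size (subst \<sigma> u)"
  let ?p = "path (replicate (Suc M) b) :: ('a, 'b) bccsp"
  obtain r where r: "step (subst (\<sigma>(x := ?p)) t) b r"
    "\<And>\<tau>. \<tau> \<in> traces r \<Longrightarrow> bcount \<tau> \<le> M" and long: "\<exists>\<tau>\<in>traces r. M \<le> length \<tau>"
    using assms(2)[of M] unfolding probe_def by blast
  obtain r' where r': "step (subst (\<sigma>(x := ?p)) u) b r'" "traces r' = traces r"
    using pf_equiv_step[OF assms(1) r(1)] by blast
  from unexposed_step[OF \<open>\<not> exposed x u\<close> r'(1)] show False
  proof
    assume "\<exists>\<delta>. \<forall>\<tau>\<in>traces ?p. \<delta> @ \<tau> \<in> traces r'"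
    moreover have "replicate (Suc M) b \<in> traces ?p" by (simp only: traces_path) blast
    ultimately obtain \<delta> where "\<delta> @ replicate (Suc M) b \<in> traces r" using r'(2) by blast
    from r(2)[OF this] show False by simp
  next
    assume "size r' < size (subst \<sigma> u)"
    moreover obtain \<tau> where "\<tau> \<in> traces r'" "M \<le> length \<tau>" using long r'(2) by blast
    ultimately show False using length_trace_le_size[of \<tau> r'] M_def by simp
  qed
qed

section \<open>Invariance under derivations\<close>

lemma step_subst: "step t c t' \<Longrightarrow> step (subst \<sigma> t) c (subst \<sigma> t')"
  by (induction rule: step.induct) (auto intro: step.intros)

lemma step_in_traces: "(\<exists>r. step p c r) \<longleftrightarrow> [c] \<in> traces p"
  by (simp add: Cons_in_traces)

text \<open>The hypothesis excludes a non-inert factor beside the moving one: its first action would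
  be \<open>b\<close> and would stay available after the step. With only inert factors beside it, a
  derivative taken from a variable keeps its traces and its probe up to the root.\<close>

lemma b_derivative_origin:
  assumes "\<And>c r. step (subst \<sigma> w) c r \<Longrightarrow> c = b \<and> [b] \<notin> traces r" "step (subst \<sigma> w) b q"
  shows "(\<exists>w'. step w b w' \<and> q = subst \<sigma> w') \<or>
    (\<exists>x r. step (\<sigma> x) b r \<and> traces r = traces q \<and> (\<forall>M. probe \<sigma> x M w))"
  using assms
proof (induction w arbitrary: q)
  case Zero
  from Zero.prems(2) show ?case by simp
next
  case (Var x)
  from Var.prems(2) have "step (\<sigma> x) b q" by simp
  then have "step (\<sigma> x) b q \<and> traces q = traces q \<and> (\<forall>M. probe \<sigma> x M (Var x))"
    using probe_Var[of \<sigma> x] by simp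
  then show ?case by (intro disjI2 exI)
next
  case (Prefix c w)
  from Prefix.prems(2) have "step (Prefix c w) b w \<and> q = subst \<sigma> w" by simp
  then show ?case by (intro disjI1 exI)
next
  case (Plus t u)
  have t: "c = b \<and> [b] \<notin> traces r" if "step (subst \<sigma> t) c r" for c r
    using Plus.prems(1)[of c r] that by (simp add: step_Plus)
  have u: "c = b \<and> [b] \<notin> traces r" if "step (subst \<sigma> u) c r" for c r
    using Plus.prems(1)[of c r] that by (simp add: step_Plus)
  from Plus.prems(2) have "step (subst \<sigma> t) b q \<or> step (subst \<sigma> u) b q" by (simp add: step_Plus)
  then show ?case
  proof
    assume "step (subst \<sigma> t) b q"
    from Plus.IH(1)[OF t this] show ?thesis
    proof
      assume "\<exists>w'. step t b w' \<and> q = subst \<sigma> w'"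
      then obtain w' where "step t b w'" "q = subst \<sigma> w'" by blast
      from step.plus_left[OF this(1)] this(2) show ?thesis by (intro disjI1 exI conjI)
    next
      assume "\<exists>x r. step (\<sigma> x) b r \<and> traces r = traces q \<and> (\<forall>M. probe \<sigma> x M t)"
      then obtain x r where x: "step (\<sigma> x) b r" "traces r = traces q" "\<forall>M. probe \<sigma> x M t" by blast
      have "\<forall>M. probe \<sigma> x M (Plus t u)" using probe_Plus[of \<sigma> x _ t u] x(3) by simp
      with x(1,2) show ?thesis by (intro disjI2 exI conjI)
    qed
  next
    assume "step (subst \<sigma> u) b q"
    from Plus.IH(2)[OF u this] show ?thesis
    proof
      assume "\<exists>w'. step u b w' \<and> q = subst \<sigma> w'"
      then obtain w' where "step u b w'" "q = subst \<sigma> w'" by blast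
      from step.plus_right[OF this(1)] this(2) show ?thesis by (intro disjI1 exI conjI)
    next
      assume "\<exists>x r. step (\<sigma> x) b r \<and> traces r = traces q \<and> (\<forall>M. probe \<sigma> x M u)"
      then obtain x r where x: "step (\<sigma> x) b r" "traces r = traces q" "\<forall>M. probe \<sigma> x M u" by blast
      have "\<forall>M. probe \<sigma> x M (Plus t u)" using probe_Plus[of \<sigma> x _ t u] x(3) by simp
      with x(1,2) show ?thesis by (intro disjI2 exI conjI)
    qed
  qed
next
  case (Par t u)
  have t: "c = b \<and> [b] \<notin> traces (Par r (subst \<sigma> u))" if "step (subst \<sigma> t) c r" for c r
    using Par.prems(1)[of c "Par r (subst \<sigma> u)"] step.par_left[OF that] by simp
  have u: "c = b \<and> [b] \<notin> traces (Par (subst \<sigma> t) r)" if "step (subst \<sigma> u) c r" for c r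
    using Par.prems(1)[of c "Par (subst \<sigma> t) r"] step.par_right[OF that] by simp
  from Par.prems(2) consider
      r where "step (subst \<sigma> t) b r" "q = Par r (subst \<sigma> u)"
    | r where "step (subst \<sigma> u) b r" "q = Par (subst \<sigma> t) r" by (auto simp: step_Par)
  then show ?case
  proof cases
    case 1
    have "inert (subst \<sigma> u)"
      unfolding inert_def
    proof (intro allI notI)
      fix c s assume s: "step (subst \<sigma> u) c s"
      then have "[c] \<in> traces (subst \<sigma> u)" using step_in_traces[of "subst \<sigma> u" c] by blast
      with u[OF s] have "[b] \<in> traces (Par r (subst \<sigma> u))"
        using traces_Par_right[of "subst \<sigma> u" r] by auto
      with t[OF 1(1)] show False by simp
    qed
    have "c = b \<and> [b] \<notin> traces r" if "step (subst \<sigma> t) c r" for c r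
      using t[OF that] traces_Par_left[of r "subst \<sigma> u"] by auto
    from Par.IH(1)[OF this 1(1)] show ?thesis
    proof
      assume "\<exists>t'. step t b t' \<and> r = subst \<sigma> t'"
      then obtain t' where "step t b t'" "r = subst \<sigma> t'" by blast
      then have "step (Par t u) b (Par t' u) \<and> q = subst \<sigma> (Par t' u)"
        using 1(2) step.par_left[of t b t' u] by simp
      then show ?thesis by (intro disjI1 exI)
    next
      assume "\<exists>x s. step (\<sigma> x) b s \<and> traces s = traces r \<and> (\<forall>M. probe \<sigma> x M t)"
      then obtain x s where x: "step (\<sigma> x) b s" "traces s = traces r" "\<forall>M. probe \<sigma> x M t"
        by blast
      moreover have "traces r = traces q"
        unfolding 1(2) using \<open>inert (subst \<sigma> u)\<close> by (rule traces_Par_inert(1)[symmetric])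
      moreover have "\<forall>M. probe \<sigma> x M (Par t u)"
        using x(3) probe_Par_inert(1)[OF _ \<open>inert (subst \<sigma> u)\<close> x(1), of _ t] by blast
      ultimately show ?thesis using x(1) by (intro disjI2 exI[of _ x] exI[of _ s]) simp
    qed
  next
    case 2
    have "inert (subst \<sigma> t)"
      unfolding inert_def
    proof (intro allI notI)
      fix c s assume s: "step (subst \<sigma> t) c s"
      then have "[c] \<in> traces (subst \<sigma> t)" using step_in_traces[of "subst \<sigma> t" c] by blast
      with t[OF s] have "[b] \<in> traces (Par (subst \<sigma> t) r)"
        using traces_Par_left[of "subst \<sigma> t" r] by auto
      with u[OF 2(1)] show False by simp
    qed
    have "c = b \<and> [b] \<notin> traces r" if "step (subst \<sigma> u) c r" for c r
      using u[OF that] traces_Par_right[of r "subst \<sigma> t"] by auto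
    from Par.IH(2)[OF this 2(1)] show ?thesis
    proof
      assume "\<exists>u'. step u b u' \<and> r = subst \<sigma> u'"
      then obtain u' where "step u b u'" "r = subst \<sigma> u'" by blast
      then have "step (Par t u) b (Par t u') \<and> q = subst \<sigma> (Par t u')"
        using 2(2) step.par_right[of u b u' t] by simp
      then show ?thesis by (intro disjI1 exI)
    next
      assume "\<exists>x s. step (\<sigma> x) b s \<and> traces s = traces r \<and> (\<forall>M. probe \<sigma> x M u)"
      then obtain x s where x: "step (\<sigma> x) b s" "traces s = traces r" "\<forall>M. probe \<sigma> x M u"
        by blast
      moreover have "traces r = traces q"
        unfolding 2(2) using \<open>inert (subst \<sigma> t)\<close> by (rule traces_Par_inert(2)[symmetric])
      moreover have "\<forall>M. probe \<sigma> x M (Par t u)"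
        using x(3) probe_Par_inert(2)[OF _ \<open>inert (subst \<sigma> t)\<close> x(1), of _ u] by blast
      ultimately show ?thesis using x(1) by (intro disjI2 exI[of _ x] exI[of _ s]) simp
    qed
  qed
qed

section \<open>Parallel compositions satisfying \<open>below\<close>\<close>

lemma choice_step:
  fixes q :: "('a, 'v) bccsp"
  assumes "traces q = traces (choice n :: ('a, 'v) bccsp)" "step q c r"
  shows "c = b \<and> [b] \<notin> traces r"
proof -
  have eq: "c # \<alpha> \<in> traces (choice n :: ('a, 'v) bccsp)" if "\<alpha> \<in> traces r" for \<alpha>
    using assms(2) that unfolding assms(1)[symmetric] Cons_in_traces by blast
  have "c = b" using eq[of "[]"] by (simp add: traces_choice_Cons)
  moreover have "[b] \<notin> traces r"
  proof
    assume "[b] \<in> traces r"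
    from eq[OF this] obtain i where "1 \<le> i" "[b] \<in> traces (branch i :: ('a, 'v) bccsp)"
      by (auto simp: traces_choice_Cons)
    then show False using single_b_notin_traces_branch by blast
  qed
  ultimately show ?thesis ..
qed

text \<open>After an \<open>a\<close>-step of \<open>p\<close> to \<open>s\<close>, the composition
  \<open>Par s q\<close> has the traces of \<open>choice n\<close>, which start with
  \<open>b\<close> but never with two \<open>b\<close>. As \<open>q\<close> is not inert, it offers
  \<open>b\<close>; a step of \<open>s\<close>, or a \<open>b\<close>-step of \<open>p\<close>,
  would leave this \<open>b\<close> available.\<close>

lemma below_Par_decomposition:
  fixes p q :: "('a, 'v) bccsp"
  assumes B: "below n (Par p q)" and "step p a p'" "\<not> inert q"
  shows "traces p = {[], [a]}" "traces q = traces (choice n :: ('a, 'v) bccsp)"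
proof -
  have T: "traces (Par s q) = traces (choice n :: ('a, 'v) bccsp)" if "step p a s" for s
    using belowD_a[OF B step.par_left[OF that]] .
  obtain c q' where "step q c q'" using assms(3) by (auto simp: inert_def)
  moreover from choice_step[OF T[OF assms(2)] step.par_right[OF this]] have "c = b" ..
  ultimately have q': "step q b q'" by simp
  then have "[b] \<in> traces q" using step_in_traces[of q b] by blast
  then have bq: "[b] \<in> traces (Par s q)" for s using traces_Par_right[of q s] by auto
  have inert: "inert s" if s: "step p a s" for s
    unfolding inert_def
  proof (intro allI notI)
    fix c s' assume "step s c s'"
    from choice_step[OF T[OF s] step.par_left[OF this]] bq[of s'] show False by simp
  qed
  show "traces q = traces (choice n :: ('a, 'v) bccsp)"
    using T[OF assms(2)] traces_Par_inert(2)[OF inert[OF assms(2)]] by simp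
  have a: "c = a" if "step p c s" for c s
  proof (rule ccontr)
    assume "c \<noteq> a"
    then have "c = b" using belowD[OF B step.par_left[OF that]] by simp
    with step.par_left[OF that, of q] have "step (Par p q) b (Par s q)" by simp
    from below_b_not_b[OF B this] bq[of s] show False by simp
  qed
  show "traces p = {[], [a]}"
  proof (rule set_eqI)
    fix \<alpha>
    have "(\<exists>s. step p c s \<and> \<beta> \<in> traces s) \<longleftrightarrow> c = a \<and> \<beta> = []" for c \<beta>
    proof
      assume "\<exists>s. step p c s \<and> \<beta> \<in> traces s"
      then obtain s where "step p c s" "\<beta> \<in> traces s" by blast
      with a[of c s] inert[of s] show "c = a \<and> \<beta> = []" by (simp add: inert_iff_traces)
    next
      assume "c = a \<and> \<beta> = []"
      with assms(2) show "\<exists>s. step p c s \<and> \<beta> \<in> traces s" by (intro exI[of _ p']) simp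
    qed
    then show "\<alpha> \<in> traces p \<longleftrightarrow> \<alpha> \<in> {[], [a]}"
      by (cases \<alpha>) (simp_all add: Cons_in_traces)
  qed
qed

text \<open>This is a pigeonhole argument: \<open>u\<close> has fewer than \<open>n\<close>
  \<open>b\<close>-derivatives of its own, but the \<open>n\<close> markers
  \<open>?w (2 * i)\<close> belong to pairwise different derivatives of its instance, so one of
  these stems from a variable.\<close>

lemma probe_from_Par:
  fixes t u :: "('a, 'v) bccsp"
  assumes B: "below n (Par (subst \<sigma> t) (subst \<sigma> u))" and t: "step (subst \<sigma> t) a p'"
    and u: "\<not> inert (subst \<sigma> u)" and n: "size u < n"
  obtains x r where "step (\<sigma> x) b r"
    "\<And>j. traces r \<noteq> traces (Par (Prefix a Zero) (branch j) :: ('a, 'v) bccsp)"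
    "\<And>M. probe \<sigma> x M (Par t u)" "\<And>M. probe \<sigma> x M (Par u t)"
proof -
  let ?w = "\<lambda>i. replicate i a @ [b]"
  note Tt = below_Par_decomposition(1)[OF B t u] and Tu = below_Par_decomposition(2)[OF B t u]
  \<comment> \<open>Beside \<open>subst \<sigma> t\<close>, each \<open>b\<close>-derivative behaves
    like a single \<open>branch k\<close> beside \<open>a\<close>, so it shows just two consecutive
    markers.\<close>
  have marker: "\<exists>k. \<forall>m. ?w m \<in> traces (Par (subst \<sigma> t) q) \<longleftrightarrow> m = 2 * k \<or> m = Suc (2 * k)"
    if q: "step (subst \<sigma> u) b q" for q
  proof -
    obtain k where "traces (Par (subst \<sigma> t) q)
        = traces (Par (Prefix a Zero) (branch k) :: ('a, 'v) bccsp)"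
      using B step.par_right[OF q] by (rule belowD_b)
    then show ?thesis using marker_in_traces_Par_branch[where ?'v = 'v, of _ k] by auto
  qed
  have der: "\<exists>q. step (subst \<sigma> u) b q \<and> ?w (2 * i) \<in> traces q" if i: "i \<in> {1..n}" for i
  proof -
    have "?w (2 * i) \<in> traces (branch i :: ('a, 'v) bccsp)" by (simp add: branch_def traces_path)
    with i have "b # ?w (2 * i) \<in> traces (subst \<sigma> u)"
      unfolding Tu traces_choice_Cons by blast
    then show ?thesis unfolding Cons_in_traces by blast
  qed
  have "\<exists>i\<in>{1..n}. \<forall>v. step u b v \<longrightarrow> ?w (2 * i) \<notin> traces (subst \<sigma> v)"
  proof (rule ccontr)
    assume "\<not> ?thesis"
    then have "\<forall>i\<in>{1..n}. \<exists>v. step u b v \<and> ?w (2 * i) \<in> traces (subst \<sigma> v)" by blast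
    then obtain f where f: "\<forall>i\<in>{1..n}. step u b (f i) \<and> ?w (2 * i) \<in> traces (subst \<sigma> (f i))"
      using bchoice[of "{1..n}" "\<lambda>i v. step u b v \<and> ?w (2 * i) \<in> traces (subst \<sigma> v)"] by blast
    \<comment> \<open>Only one of \<open>2 * k\<close> and \<open>Suc (2 * k)\<close> is even, so no
      derivative contains two different even markers.\<close>
    have "inj_on f {1..n}"
    proof (rule inj_onI)
      fix i j assume ij: "i \<in> {1..n}" "j \<in> {1..n}" "f i = f j"
      have "step (subst \<sigma> u) b (subst \<sigma> (f i))" using f ij(1) step_subst[of u b "f i" \<sigma>] by blast
      from marker[OF this] obtain k where k: "\<And>m. ?w m \<in> traces (Par (subst \<sigma> t) (subst \<sigma> (f i)))
        \<longleftrightarrow> m = 2 * k \<or> m = Suc (2 * k)" by blast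
      have "?w (2 * i) \<in> traces (subst \<sigma> (f i))" "?w (2 * j) \<in> traces (subst \<sigma> (f i))"
        using bspec[OF f ij(1)] bspec[OF f ij(2)] unfolding ij(3) by blast+
      then have "?w (2 * i) \<in> traces (Par (subst \<sigma> t) (subst \<sigma> (f i)))"
        "?w (2 * j) \<in> traces (Par (subst \<sigma> t) (subst \<sigma> (f i)))" using traces_Par_right[of "subst \<sigma> (f i)" "subst \<sigma> t"] by auto
      then have "2 * i = 2 * k \<or> 2 * i = Suc (2 * k)" "2 * j = 2 * k \<or> 2 * j = Suc (2 * k)"
        unfolding k .
      then show "i = j" by presburger
    qed
    moreover have "f ` {1..n} \<subseteq> {v. step u b v}" using f by blast
    ultimately have "card {1..n} \<le> card {v. step u b v}"
      using derivatives_bounded[of u b] card_inj_on_le[of f "{1..n}" "{v. step u b v}"] by simp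
    then show False using derivatives_bounded[of u b] n by simp
  qed
  then obtain i where i: "i \<in> {1..n}" "\<And>v. step u b v \<Longrightarrow> ?w (2 * i) \<notin> traces (subst \<sigma> v)"
    by blast
  from der[OF i(1)] obtain q where q: "step (subst \<sigma> u) b q" "?w (2 * i) \<in> traces q" by blast
  \<comment> \<open>The marker missing from every \<open>subst \<sigma> v\<close> rules out that
    \<open>q\<close> comes from a prefix of \<open>u\<close>.\<close>
  from b_derivative_origin[OF choice_step[OF Tu] q(1)] i(2) q(2)
  obtain x r where x: "step (\<sigma> x) b r" "traces r = traces q" "\<And>M. probe \<sigma> x M u" by blast
  show ?thesis
  proof (rule that)
    show "step (\<sigma> x) b r" by fact
  next
    fix j
    show "traces r \<noteq> traces (Par (Prefix a Zero) (branch j) :: ('a, 'v) bccsp)"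
    proof
      \<comment> \<open>Adding the \<open>a\<close> of \<open>subst \<sigma> t\<close> to the larger
        marker would put both \<open>2 * j\<close> and \<open>2 * j + 2\<close> into one
        composition, which no \<open>k\<close> allows.\<close>
      assume "traces r = traces (Par (Prefix a Zero) (branch j) :: ('a, 'v) bccsp)"
      then have w: "?w (2 * j) \<in> traces q" "?w (Suc (2 * j)) \<in> traces q"
        unfolding x(2)[symmetric] using marker_in_traces_Par_branch[where ?'v = 'v, of _ j] by blast+
      from marker[OF q(1)] obtain k where k: "\<And>m. ?w m \<in> traces (Par (subst \<sigma> t) q)
        \<longleftrightarrow> m = 2 * k \<or> m = Suc (2 * k)" by blast
      have "?w (2 * j) \<in> traces (Par (subst \<sigma> t) q)" using w(1) traces_Par_right[of q "subst \<sigma> t"] by auto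
      moreover have "[a] @ ?w (Suc (2 * j)) \<in> traces (Par (subst \<sigma> t) q)"
        by (rule append_traces_Par[OF _ w(2)]) (simp add: Tt)
      then have "?w (Suc (Suc (2 * j))) \<in> traces (Par (subst \<sigma> t) q)" by simp
      ultimately show False unfolding k by presburger
    qed
  next
    \<comment> \<open>An occurrence of \<open>x\<close> would bring a \<open>b\<close> into the
      traces of \<open>subst \<sigma> t\<close>, which are only \<open>[]\<close> and
      \<open>[a]\<close>.\<close>
    have xt: "x \<notin> vars t"
    proof
      assume "x \<in> vars t"
      from traces_reach_var[OF this, of \<sigma>] obtain \<delta>
        where \<delta>: "\<forall>\<tau>\<in>traces (\<sigma> x). \<delta> @ \<tau> \<in> traces (subst \<sigma> t)" ..
      have "[b] \<in> traces (\<sigma> x)" using x(1) step_in_traces[of "\<sigma> x" b] by blast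
      with \<delta> have "\<delta> @ [b] \<in> {[], [a]}" unfolding Tt ..
      then show False using neq by (cases \<delta>) auto
    qed
    have "b \<notin> set \<gamma>" if "\<gamma> \<in> traces (subst \<sigma> t)" for \<gamma>
      using that neq unfolding Tt by auto
    note * = probe_Par[OF x(3) xt this]
    show "probe \<sigma> x M (Par t u)" "probe \<sigma> x M (Par u t)" for M
      by (rule *(2), assumption) (rule *(1), assumption)
  qed
qed

text \<open>The alternatives record whether the mixed summand lies within the value of a variable or
  is created by a \<open>Par\<close> of \<open>t\<close> with two non-inert factors, where
  \<open>probe_from_Par\<close> applies. The probes serve to find \<open>x\<close> again on the
  other side of an axiom.\<close>

lemma mixed_origin:
  fixes t :: "('a, 'v) bccsp"
  assumes "below n (subst \<sigma> t)" "size t < n" "mixed (subst \<sigma> t)"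
  shows "\<exists>x r. step (\<sigma> x) b r \<and> (mixed (\<sigma> x) \<or>
      (\<forall>j. traces r \<noteq> traces (Par (Prefix a Zero) (branch j) :: ('a, 'v) bccsp))) \<and>
    (\<forall>M. probe \<sigma> x M t)"
  using assms
proof (induction t)
  case (Var x)
  then obtain r where "step (\<sigma> x) b r" using mixed_steps[of "\<sigma> x" b] by auto
  then show ?case using Var.prems(3) probe_Var[of \<sigma> x] by (intro exI[of _ x] exI[of _ r]) simp
next
  case (Plus t u)
  from Plus.prems(3) have "mixed (subst \<sigma> t) \<or> mixed (subst \<sigma> u)" by simp
  then show ?case
  proof
    assume "mixed (subst \<sigma> t)"
    with Plus show ?thesis using probe_Plus[of \<sigma> _ _ t u] by (simp add: below_Plus) blast
  next
    assume "mixed (subst \<sigma> u)"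
    with Plus show ?thesis using probe_Plus[of \<sigma> _ _ t u] by (simp add: below_Plus) blast
  qed
next
  case (Par t u)
  have B: "below n (Par (subst \<sigma> t) (subst \<sigma> u))" using Par.prems(1) by simp
  consider "inert (subst \<sigma> u)" | "\<not> inert (subst \<sigma> u)" "inert (subst \<sigma> t)"
    | "\<not> inert (subst \<sigma> u)" "\<not> inert (subst \<sigma> t)" by blast
  then show ?case
  proof cases
    case 1
    from Par.prems(3) 1 have "mixed (subst \<sigma> t)" by simp
    with Par.IH(1)[OF below_Par_inert(1)[OF B 1]] Par.prems(2) show ?thesis
      using probe_Par_inert(1)[of \<sigma> _ _ t u, OF _ 1] by simp blast
  next
    case 2
    from Par.prems(3) 2 have "mixed (subst \<sigma> u)" by simp
    with Par.IH(2)[OF below_Par_inert(2)[OF B 2(2)]] Par.prems(2) show ?thesis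
      using probe_Par_inert(2)[of \<sigma> _ _ u t, OF _ 2(2)] by simp blast
  next
    case 3
    from Par.prems(3) 3 have "\<exists>r. step (Par (subst \<sigma> t) (subst \<sigma> u)) a r" by simp
    then consider p where "step (subst \<sigma> t) a p" | p where "step (subst \<sigma> u) a p"
      by (auto simp: step_Par)
    then show ?thesis
    proof cases
      case a: 1
      have "size u < n" using Par.prems(2) by simp
      from probe_from_Par[OF B a 3(1) this] show ?thesis by metis
    next
      case a: 2
      have "size t < n" using Par.prems(2) by simp
      from probe_from_Par[OF below_Par_commute[OF B] a 3(2) this] show ?thesis by metis
    qed
  qed
qed simp_all

text \<open>The probes force \<open>x\<close> to be exposed in \<open>u\<close>. A mixed value makes
  the instance of \<open>u\<close> mixed at once. In the other case \<open>r\<close> lacks the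
  traces that \<open>below\<close> demands of \<open>b\<close>-derivatives, so
  \<open>exposed_mixed_or_step\<close> leaves only \<open>mixed\<close>.\<close>

lemma sound_mixed:
  fixes t u :: "('a, 'v) bccsp"
  assumes sound: "\<And>\<sigma>. subst \<sigma> t \<sim>PF subst \<sigma> u"
    and B: "below n (subst \<sigma> t)" and "size t < n" "mixed (subst \<sigma> t)"
  shows "mixed (subst \<sigma> u)"
proof -
  obtain x r where x: "step (\<sigma> x) b r" "\<And>M. probe \<sigma> x M t" and
    r: "mixed (\<sigma> x) \<or>
      (\<forall>j. traces r \<noteq> traces (Par (Prefix a Zero) (branch j) :: ('a, 'v) bccsp))"
    using mixed_origin[OF assms(2-4)] by blast
  have e: "exposed x u" using sound x(2) by (rule exposed_if_probe)
  have Bu: "below n (subst \<sigma> u)" using sound B by (rule below_cong)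
  from r show ?thesis
  proof
    assume "mixed (\<sigma> x)"
    with e show ?thesis by (rule exposed_mixed)
  next
    assume r: "\<forall>j. traces r \<noteq> traces (Par (Prefix a Zero) (branch j) :: ('a, 'v) bccsp)"
    from exposed_mixed_or_step[OF e x(1) Bu] show ?thesis
    proof
      assume "\<exists>r'. step (subst \<sigma> u) b r' \<and> traces r' = traces r"
      then obtain r' where r': "step (subst \<sigma> u) b r'" "traces r' = traces r" by blast
      obtain j where "traces r' = traces (Par (Prefix a Zero) (branch j) :: ('a, 'v) bccsp)"
        using Bu r'(1) by (rule belowD_b)
      with r r'(2) show ?thesis by metis
    qed
  qed
qed

text \<open>\<open>below\<close> is invariant under equivalence, so it can be carried along
  transitivity and symmetry; it also passes to summands and to a factor beside an inert one, which
  makes the induction hypotheses applicable.\<close>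

lemma derivable_mixed:
  assumes sound: "sound pf_equiv E" and n: "\<And>t u. (t, u) \<in> E \<Longrightarrow> size t < n \<and> size u < n"
    and "derivable E t u" "below n t"
  shows "mixed t \<longleftrightarrow> mixed u"
  using assms(3,4)
proof induction
  case (sym t u)
  have "below n t"
    using pf_equiv_sym[OF derivable_pf_equiv[OF sound sym.hyps]] sym.prems by (rule below_cong)
  with sym.IH show ?case by simp
next
  case (trans t u v)
  have "below n u"
    using derivable_pf_equiv[OF sound trans.hyps(1)] trans.prems by (rule below_cong)
  with trans show ?case by simp
next
  case (inst t u \<sigma>)
  have s: "subst \<sigma> t \<sim>PF subst \<sigma> u" for \<sigma>
    using sound inst.hyps by (intro sound_eq_subst) (auto simp: sound_def)
  have B: "below n (subst \<sigma> u)" using s inst.prems by (rule below_cong)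
  show ?case
    using sound_mixed[OF s inst.prems] sound_mixed[OF pf_equiv_sym[OF s] B] n[OF inst.hyps] by blast
next
  case (plus t u t' u')
  then show ?case by (simp add: below_Plus)
next
  case (par t u t' u')
  have T: "traces t = traces u" "traces t' = traces u'"
    using par.hyps derivable_pf_equiv[OF sound] pf_equiv_traces by blast+
  have I: "inert t = inert u" "inert t' = inert u'" using T by (simp_all add: inert_iff_traces)
  consider "inert t'" | "\<not> inert t'" "inert t" | "\<not> inert t'" "\<not> inert t" by blast
  then show ?case
  proof cases
    case 1
    with par.IH(1)[OF below_Par_inert(1)[OF par.prems 1]] I show ?thesis by simp
  next
    case 2
    with par.IH(2)[OF below_Par_inert(2)[OF par.prems 2(2)]] I show ?thesis by simp
  next
    case 3
    \<comment> \<open>With two non-inert factors \<open>mixed\<close> asks only for initial actions,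
      which the traces determine; \<open>below\<close> need not pass to such factors.\<close>
    have "traces (Par t t') = traces (Par u u')" unfolding traces_Par T ..
    with 3 I show ?thesis by (simp add: step_in_traces)
  qed
qed simp_all

text \<open>The left side is mixed because its factors offer \<open>a\<close> and \<open>b\<close>
  respectively, where \<open>1 \<le> n\<close> keeps \<open>choice n\<close> from being inert. The
  right side is a sum of prefixes, none of which is mixed.\<close>

lemma expansion_not_derivable:
  fixes E :: "(('a, 'v) bccsp \<times> ('a, 'v) bccsp) set"
  assumes sound: "sound pf_equiv E" and n: "\<And>t u. (t, u) \<in> E \<Longrightarrow> size t < n \<and> size u < n"
    and "1 \<le> n"
  shows "\<not> derivable E (Par (Prefix a Zero) (choice n))
    (Plus (Prefix a (Par Zero (choice n))) (expansion n))" (is "\<not> derivable E ?l ?r")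
proof
  assume "derivable E ?l ?r"
  moreover have "below n ?l"
  proof (rule belowI)
    fix c r assume "step ?l c r"
    moreover have "inert (Zero :: ('a, 'v) bccsp)" by (simp add: inert_def)
    ultimately show "c = a \<and> traces r = traces (choice n :: ('a, 'v) bccsp) \<or>
      c = b \<and> (\<exists>i\<in>{1..n}. traces r = traces (Par (Prefix a Zero) (branch i) :: ('a, 'v) bccsp))"
      by (auto simp: step_Par step_choice traces_Par_inert)
  qed
  ultimately have "mixed ?l \<longleftrightarrow> mixed ?r" using derivable_mixed[OF sound n] by blast
  moreover have "mixed ?l"
  proof (rule mixed_ParI)
    have b: "step (choice n) b (branch 1)" using \<open>1 \<le> n\<close> by (auto simp: step_choice)
    then show "(\<exists>r. step (Prefix a Zero) b r) \<or> (\<exists>r. step (choice n :: ('a, 'v) bccsp) b r)"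
      "\<not> inert (choice n :: ('a, 'v) bccsp)" by (auto simp: inert_def)
    show "\<not> inert (Prefix a Zero :: ('a, 'v) bccsp)" by (simp add: inert_def)
  qed simp
  moreover have "\<not> mixed (expansion n :: ('a, 'v) bccsp)" by (induction n) simp_all
  ultimately show False by simp
qed

end

theorem theorem6p2:
  assumes "card (UNIV :: 'a::finite set) \<ge> 2"
    and "infinite (UNIV :: 'v::countable set)"
  shows "\<not> (\<exists>E :: (('a, 'v) bccsp \<times> ('a, 'v) bccsp) set.
            finite E \<and> sound pf_equiv E \<and> ground_complete pf_equiv E)"
proof
  assume "\<exists>E :: (('a, 'v) bccsp \<times> ('a, 'v) bccsp) set.
    finite E \<and> sound pf_equiv E \<and> ground_complete pf_equiv E"
  then obtain E :: "(('a, 'v) bccsp \<times> ('a, 'v) bccsp) set"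
    where E: "finite E" "sound pf_equiv E" "ground_complete pf_equiv E" by blast
  have "\<exists>a b :: 'a. a \<noteq> b"
  proof (rule ccontr)
    assume "\<not> ?thesis"
    then have "UNIV = {undefined :: 'a}" by auto
    then have "card (UNIV :: 'a set) = 1" by (metis card_1_singleton_iff One_nat_def)
    with assms(1) show False by simp
  qed
  then obtain a b :: 'a where "a \<noteq> b" by blast
  then interpret two_actions a b by unfold_locales
  \<comment> \<open>\<open>Suc\<close> makes the bound strict for every axiom and ensures
    \<open>1 \<le> n\<close> even for empty \<open>E\<close>.\<close>
  define n where "n = Suc (\<Sum>(t, u)\<in>E. size t + size u)"
  have n: "size t < n \<and> size u < n" if "(t, u) \<in> E" for t u
    using member_le_sum[OF that, of "\<lambda>(t, u). size t + size u"] E(1) by (simp add: n_def)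
  have "is_closed (Par (Prefix a Zero) (choice n) :: ('a, 'v) bccsp)"
    "is_closed (Plus (Prefix a (Par Zero (choice n))) (expansion n) :: ('a, 'v) bccsp)"
    using choice_closed[where ?'b = 'v, of n] expansion_closed[where ?'b = 'v, of n]
    by (simp_all add: is_closed_def)
  then have "derivable E (Par (Prefix a Zero) (choice n))
      (Plus (Prefix a (Par Zero (choice n))) (expansion n))"
    using E(3) expansion_law unfolding ground_complete_def by blast
  with expansion_not_derivable[OF E(2) n] show False by (simp add: n_def)
qed

end
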